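(* Let $\Gamma$ be an infinite cardinal such that $\Gamma^\omega=\Gamma$. Then $\ell_2(\Gamma)$ admits a lattice tiling by translates of a symmetric and bounded convex body; that is, there are a bounded convex body $B\subseteq \ell_2(\Gamma)$ with $B=-B$ and a discrete subgroup $\mathcal{D}$ of $(\ell_2(\Gamma),+)$ such that $\{d+B\colon d\in\mathcal{D}\}$ is a tiling of $\ell_2(\Gamma)$. Therefore, there exists an equivalent norm $|||\cdot|||$ on $\ell_2(\Gamma)$ such that $(\ell_2(\Gamma),|||\cdot|||)$ admits a lattice tiling by balls.
   Context: All spaces are over the real field. $\Gamma^\omega$ denotes cardinal exponentiation (the cardinality of the set of all sequences with values in $\Gamma$). A body in a normed space is a set that is the closure of its non-empty interior; a convex body is a closed convex set with non-empty interior. A tiling of a normed space $\mathcal{X}$ is a family of bodies that covers $\mathcal{X}$ and whose members have mutually disjoint interiors. A tiling $\mathcal{T}$ of $\mathcal{X}$ is a lattice tiling if there are a body $B$ and a (discrete) subgroup $\mathcal{D}$ of $\mathcal{X}$ such that $\mathcal{T}=\{d+B\colon d\in\mathcal{D}\}$; if $B$ is the closed unit ball $B_{\mathcal{X}}$ of $\mathcal{X}$, $\mathcal{T}$ is called a lattice tiling by balls. *)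

theory Defs
  imports "HOL-Analysis.Analysis"
begin

section \<open>The Hilbert space of square-summable families\<close>

text \<open>The index set is the universe of the type variable \<open>'g\<close>, so that the cardinal in question
  is the cardinality of that type.\<close>

typedef 'g ell2 = "{f :: 'g \<Rightarrow> real. (\<lambda>i. (f i)\<^sup>2) summable_on UNIV}"
  morphisms coord Abs_ell2
  by (rule exI[of _ "\<lambda>_. 0"]) simp

setup_lifting type_definition_ell2

lemma summable_on_mult_of_squares:
  fixes f g :: "'g \<Rightarrow> real"
  assumes "(\<lambda>i. (f i)\<^sup>2) summable_on UNIV" "(\<lambda>i. (g i)\<^sup>2) summable_on UNIV"
  shows "(\<lambda>i. f i * g i) summable_on UNIV"
proof -
  have "(\<lambda>i. norm (f i * g i)) summable_on UNIV"
  proof (rule Infinite_Sum.abs_summable_on_comparison_test)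
    have "(\<lambda>i. (f i)\<^sup>2 + (g i)\<^sup>2) summable_on UNIV"
      using assms by (rule summable_on_add)
    then show "(\<lambda>i. norm ((f i)\<^sup>2 + (g i)\<^sup>2)) summable_on UNIV"
      by (simp only: summable_on_iff_abs_summable_on_real[symmetric])
    show "norm (f i * g i) \<le> norm ((f i)\<^sup>2 + (g i)\<^sup>2)" for i
    proof -
      have "2 * \<bar>f i\<bar> * \<bar>g i\<bar> \<le> (f i)\<^sup>2 + (g i)\<^sup>2"
        using sum_squares_bound[of "\<bar>f i\<bar>" "\<bar>g i\<bar>"] by simp
      moreover have "0 \<le> \<bar>f i\<bar> * \<bar>g i\<bar>" by simp
      ultimately have "\<bar>f i\<bar> * \<bar>g i\<bar> \<le> (f i)\<^sup>2 + (g i)\<^sup>2" by linarith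
      then show ?thesis by (simp add: abs_mult)
    qed
  qed
  then show ?thesis by (simp only: summable_on_iff_abs_summable_on_real[symmetric])
qed

lemma summable_on_add_square:
  fixes f g :: "'g \<Rightarrow> real"
  assumes "(\<lambda>i. (f i)\<^sup>2) summable_on UNIV" "(\<lambda>i. (g i)\<^sup>2) summable_on UNIV"
  shows "(\<lambda>i. (f i + g i)\<^sup>2) summable_on UNIV"
proof -
  have "(\<lambda>i. (f i)\<^sup>2 + (g i)\<^sup>2 + 2 * (f i * g i)) summable_on UNIV"
    by (intro summable_on_add summable_on_cmult_right summable_on_mult_of_squares assms)
  moreover have "(f i)\<^sup>2 + (g i)\<^sup>2 + 2 * (f i * g i) = (f i + g i)\<^sup>2" for i
    by (simp only: power2_sum mult.assoc)
  ultimately show ?thesis by simp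
qed

instantiation ell2 :: (type) real_vector
begin

lift_definition zero_ell2 :: "'g ell2" is "\<lambda>_. 0" by simp

lift_definition plus_ell2 :: "'g ell2 \<Rightarrow> 'g ell2 \<Rightarrow> 'g ell2" is "\<lambda>f g i. f i + g i"
  by (rule summable_on_add_square)

lift_definition uminus_ell2 :: "'g ell2 \<Rightarrow> 'g ell2" is "\<lambda>f i. - f i" by simp

lift_definition minus_ell2 :: "'g ell2 \<Rightarrow> 'g ell2 \<Rightarrow> 'g ell2" is "\<lambda>f g i. f i - g i"
  subgoal for f g using summable_on_add_square[of f "\<lambda>i. - g i"] by simp
  done

lift_definition scaleR_ell2 :: "real \<Rightarrow> 'g ell2 \<Rightarrow> 'g ell2" is "\<lambda>c f i. c * f i"
  by (simp add: power_mult_distrib summable_on_cmult_right)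

instance
proof
  fix x y z :: "'g ell2" and a b :: real
  show "x + y + z = x + (y + z)" by transfer (simp add: add.assoc)
  show "x + y = y + x" by transfer (simp add: add.commute)
  show "0 + x = x" by transfer simp
  show "- x + x = 0" by transfer simp
  show "x - y = x + - y" by transfer simp
  show "a *\<^sub>R (x + y) = a *\<^sub>R x + a *\<^sub>R y" by transfer (simp add: distrib_left)
  show "(a + b) *\<^sub>R x = a *\<^sub>R x + b *\<^sub>R x" by transfer (simp add: distrib_right)
  show "a *\<^sub>R b *\<^sub>R x = (a * b) *\<^sub>R x" by transfer (simp add: mult.assoc)
  show "1 *\<^sub>R x = x" by transfer simp
qed

end

instantiation ell2 :: (type) real_inner
begin

lift_definition inner_ell2 :: "'g ell2 \<Rightarrow> 'g ell2 \<Rightarrow> real" is "\<lambda>f g. \<Sum>\<^sub>\<infinity>i. f i * g i" .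

lift_definition norm_ell2 :: "'g ell2 \<Rightarrow> real" is "\<lambda>f. sqrt (\<Sum>\<^sub>\<infinity>i. (f i)\<^sup>2)" .

definition sgn_ell2 :: "'g ell2 \<Rightarrow> 'g ell2" where "sgn_ell2 x = x /\<^sub>R norm x"

definition dist_ell2 :: "'g ell2 \<Rightarrow> 'g ell2 \<Rightarrow> real" where "dist_ell2 x y = norm (x - y)"

definition uniformity_ell2 :: "('g ell2 \<times> 'g ell2) filter"
  where "uniformity_ell2 = (INF e\<in>{0<..}. principal {(x, y). dist x y < e})"

definition open_ell2 :: "'g ell2 set \<Rightarrow> bool"
  where "open_ell2 U = (\<forall>x\<in>U. \<forall>\<^sub>F (x', y) in uniformity. x' = x \<longrightarrow> y \<in> U)"

instance
proof
  fix x y z :: "'g ell2" and r :: real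
  show "dist x y = norm (x - y)" by (rule dist_ell2_def)
  show "sgn x = x /\<^sub>R norm x" by (rule sgn_ell2_def)
  show "uniformity = (INF e\<in>{0<..}. principal {(x, y::'g ell2). dist x y < e})"
    by (rule uniformity_ell2_def)
  show "open U = (\<forall>x\<in>U. \<forall>\<^sub>F (x', y) in uniformity. x' = x \<longrightarrow> y \<in> U)" for U :: "'g ell2 set"
    by (rule open_ell2_def)
  show "inner x y = inner y x" by transfer (simp add: mult.commute)
  show "inner (x + y) z = inner x z + inner y z"
    by transfer (simp add: distrib_right infsum_add summable_on_mult_of_squares)
  show "inner (r *\<^sub>R x) y = r * inner x y"
    by transfer (simp add: mult.assoc infsum_cmult_right')
  show "0 \<le> inner x x" by transfer (simp add: infsum_nonneg)
  show "inner x x = 0 \<longleftrightarrow> x = 0"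
  proof transfer
    fix f :: "'g \<Rightarrow> real" assume f: "(\<lambda>i. (f i)\<^sup>2) summable_on UNIV"
    show "(\<Sum>\<^sub>\<infinity>i. f i * f i) = 0 \<longleftrightarrow> f = (\<lambda>_. 0)"
    proof
      assume "(\<Sum>\<^sub>\<infinity>i. f i * f i) = 0"
      then have "(f i)\<^sup>2 = 0" for i
        using nonneg_infsum_le_0D[of "\<lambda>i. (f i)\<^sup>2" UNIV i] f by (simp add: power2_eq_square)
      then show "f = (\<lambda>_. 0)" by auto
    qed simp
  qed
  show "norm x = sqrt (inner x x)" by transfer (simp add: power2_eq_square)
qed

end


section \<open>Bodies and tilings\<close>

text \<open>These notions are relative to an explicit topology, since they are needed both for the
  Hilbert norm (topology \<open>euclidean\<close>) and for a renorming.\<close>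

definition body_in :: "'a topology \<Rightarrow> 'a set \<Rightarrow> bool"
  where "body_in X B \<longleftrightarrow> X interior_of B \<noteq> {} \<and> B = X closure_of (X interior_of B)"

definition convex_body_in :: "'a::real_vector topology \<Rightarrow> 'a set \<Rightarrow> bool"
  where "convex_body_in X B \<longleftrightarrow> closedin X B \<and> convex B \<and> X interior_of B \<noteq> {}"

definition tiling :: "'a topology \<Rightarrow> 'a set set \<Rightarrow> bool"
  where "tiling X \<T> \<longleftrightarrow>
    (\<forall>T\<in>\<T>. body_in X T) \<and>
    \<Union>\<T> = topspace X \<and>
    pairwise (\<lambda>S T. disjnt (X interior_of S) (X interior_of T)) \<T>"

definition additive_subgroup :: "'a::group_add set \<Rightarrow> bool"
  where "additive_subgroup D \<longleftrightarrow> 0 \<in> D \<and> (\<forall>x\<in>D. \<forall>y\<in>D. x + y \<in> D) \<and> (\<forall>x\<in>D. - x \<in> D)"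

definition discrete_subgroup :: "'a::group_add topology \<Rightarrow> 'a set \<Rightarrow> bool"
  where "discrete_subgroup X D \<longleftrightarrow>
    additive_subgroup D \<and> subtopology X D = discrete_topology D"

definition lattice_tiling_by :: "'a::group_add topology \<Rightarrow> 'a set \<Rightarrow> 'a set \<Rightarrow> bool"
  where "lattice_tiling_by X B D \<longleftrightarrow>
    body_in X B \<and> discrete_subgroup X D \<and> tiling X {(+) d ` B |d. d \<in> D}"


section \<open>Equivalent norms\<close>

definition is_norm :: "('a::real_vector \<Rightarrow> real) \<Rightarrow> bool"
  where "is_norm N \<longleftrightarrow>
    (\<forall>x. 0 \<le> N x) \<and> (\<forall>x. N x = 0 \<longleftrightarrow> x = 0) \<and>
    (\<forall>c x. N (c *\<^sub>R x) = \<bar>c\<bar> * N x) \<and> (\<forall>x y. N (x + y) \<le> N x + N y)"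

definition equivalent_norm :: "('a::real_normed_vector \<Rightarrow> real) \<Rightarrow> bool"
  where "equivalent_norm N \<longleftrightarrow>
    is_norm N \<and> (\<exists>c>0. \<exists>C>0. \<forall>x. c * norm x \<le> N x \<and> N x \<le> C * norm x)"

definition norm_topology :: "('a::real_vector \<Rightarrow> real) \<Rightarrow> 'a topology"
  where "norm_topology N = Metric_space.mtopology UNIV (\<lambda>x y. N (x - y))"

lemma norm_topology_norm: "norm_topology norm = (euclidean :: 'a::real_normed_vector topology)"
  unfolding norm_topology_def dist_norm[symmetric] by (rule mtopology_is_euclidean)

definition admits_lattice_tiling_by_balls :: "('a::real_vector \<Rightarrow> real) \<Rightarrow> bool"
  where "admits_lattice_tiling_by_balls N \<longleftrightarrow>
    (\<exists>D. lattice_tiling_by (norm_topology N) {x. N x \<le> 1} D)"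

unbundle cardinal_syntax

end

theory Submission
  imports Defs
begin

text \<open>The tile is the Voronoi cell of a subgroup \<open>D\<close> whose nonzero elements have norm at least
  \<open>\<surd>2\<close> and which meets every closed unit ball. Vectors of norm at most \<open>s < 1\<close> with mutual
  distances at least \<open>\<surd>2\<close> have inner products bounded above by \<open>s\<^sup>2 - 1 < 0\<close>, so there are only
  finitely many of them; hence every point has a nearest element of \<open>D\<close> and the cells cover the
  space. The Minkowski gauge of the cell is the equivalent norm.

  To obtain \<open>D\<close>, enumerate all points of the space along a well-order of \<open>\<Gamma>\<close> of minimal type, which is
  possible since \<open>\<Gamma>\<^sup>\<omega> = \<Gamma>\<close>. As supports are countable and \<open>\<Gamma>\<close> is uncountable, each step has an
  unused coordinate \<open>\<gamma>\<close>. If the current point \<open>x\<close> is at distance at least \<open>1\<close> from the group built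
  so far, add the generator \<open>x + e\<^sub>\<gamma>\<close>.\<close>

section \<open>Voronoi cells of separated and dense subgroups\<close>

text \<open>For \<open>n \<ge> 1\<close> members of \<open>S\<close>, expanding the squared norm of
  their sum gives \<open>0 \<le> n * (s - \<delta> * (n - 1))\<close>, so \<open>n\<close> is at
  most \<open>s / \<delta> + 1\<close>.\<close>

lemma finite_obtuse:
  fixes S :: "'a::real_inner set"
  assumes le: "\<And>u. u \<in> S \<Longrightarrow> u \<bullet> u \<le> s"
    and sep: "\<And>u v. u \<in> S \<Longrightarrow> v \<in> S \<Longrightarrow> u \<noteq> v \<Longrightarrow> u \<bullet> v \<le> - \<delta>"
    and "\<delta> > 0"
  shows "finite S"
proof -
  have "card G \<le> nat \<lceil>s / \<delta> + 1\<rceil>" if "G \<subseteq> S" "finite G" for G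
  proof (cases "G = {}")
    case False
    have "0 \<le> (\<Sum>u\<in>G. u) \<bullet> (\<Sum>u\<in>G. u)"
      by simp
    also have "\<dots> = (\<Sum>u\<in>G. \<Sum>v\<in>G. u \<bullet> v)"
      by (subst inner_sum_left) (simp add: inner_sum_right)
    also have "\<dots> \<le> (\<Sum>u\<in>G. s - \<delta> * (real (card G) - 1))"
    proof (rule sum_mono)
      fix u assume u: "u \<in> G"
      have card: "real (card (G - {u})) = real (card G) - 1"
        using card_Suc_Diff1[OF that(2) u] by linarith
      have "(\<Sum>v\<in>G. u \<bullet> v) = u \<bullet> u + (\<Sum>v\<in>G - {u}. u \<bullet> v)"
        using that u by (simp add: sum.remove)
      also have "\<dots> \<le> s + (\<Sum>v\<in>G - {u}. - \<delta>)"
        using that u by (intro add_mono sum_mono le sep) auto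
      also have "\<dots> = s - \<delta> * (real (card G) - 1)"
        by (simp only: sum_constant card) (simp add: algebra_simps)
      finally show "(\<Sum>v\<in>G. u \<bullet> v) \<le> s - \<delta> * (real (card G) - 1)" .
    qed
    also have "\<dots> = real (card G) * (s - \<delta> * (real (card G) - 1))"
      by simp
    finally have "0 \<le> s - \<delta> * (real (card G) - 1)"
      using False that by (simp add: zero_le_mult_iff card_gt_0_iff)
    then have "real (card G) \<le> s / \<delta> + 1"
      using \<open>\<delta> > 0\<close> by (simp add: field_simps)
    then show ?thesis by linarith
  qed simp
  then show ?thesis
    using finite_if_finite_subsets_card_bdd by blast
qed

text \<open>Contracting towards \<open>x\<close> turns the ball into a smaller one around
  \<open>(1 - t) *\<^sub>R x\<close>, which convexity keeps inside \<open>B\<close>; then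
  \<open>t\<close> tends to 0.\<close>

lemma subset_closure_interior:
  fixes B :: "'a::real_normed_vector set"
  assumes "convex B" "ball 0 \<rho> \<subseteq> B" "\<rho> > 0"
  shows "B \<subseteq> closure (interior B)"
proof
  fix x assume x: "x \<in> B"
  have int: "(1 - t) *\<^sub>R x \<in> interior B" if t: "0 < t" "t \<le> 1" for t :: real
  proof (rule interiorI)
    let ?U = "(\<lambda>z. (1 - t) *\<^sub>R x + t *\<^sub>R z) ` ball 0 \<rho>"
    have "?U = (+) ((1 - t) *\<^sub>R x) ` (*\<^sub>R) t ` ball 0 \<rho>"
      by (simp add: image_image)
    then show "open ?U"
      using t by (metis open_ball open_scaling open_translation less_irrefl)
    show "(1 - t) *\<^sub>R x \<in> ?U"
      using \<open>\<rho> > 0\<close> by (intro image_eqI[of _ _ 0]) auto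
    show "?U \<subseteq> B"
      using assms x t by (auto intro!: convexD)
  qed
  show "x \<in> closure (interior B)"
    unfolding closure_approachable
  proof (intro allI impI)
    fix \<epsilon> :: real assume \<epsilon>: "\<epsilon> > 0"
    \<comment> \<open>Caps the displacement \<open>t * norm x\<close> at
      \<open>\<epsilon> / 2\<close>; the \<open>+ 1\<close> avoids division by zero at
      \<open>x = 0\<close>.\<close>
    define t where "t = min 1 (\<epsilon> / (2 * (norm x + 1)))"
    have pos: "norm x + 1 > 0"
      using norm_ge_zero[of x] by linarith
    have t: "0 < t" "t \<le> 1"
      using \<epsilon> pos by (auto simp: t_def)
    have "dist ((1 - t) *\<^sub>R x) x = t * norm x"
      using t by (simp add: dist_norm algebra_simps)
    also have "\<dots> \<le> t * (norm x + 1)"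
      using t by simp
    also have "\<dots> \<le> \<epsilon> / (2 * (norm x + 1)) * (norm x + 1)"
      using pos by (intro mult_right_mono) (auto simp: t_def)
    also have "\<dots> = \<epsilon> / 2"
      using pos by (auto simp: divide_simps)
    also have "\<dots> < \<epsilon>"
      using \<epsilon> by simp
    finally show "\<exists>y\<in>interior B. dist y x < \<epsilon>"
      using int[OF t] by blast
  qed
qed

text \<open>The two-sided estimate nests the balls of the two metrics, with radii
  \<open>r / C\<close> and \<open>c * r\<close>. It transfers a tiling from the original norm to the
  gauge.\<close>

lemma norm_topology_equivalent:
  assumes "equivalent_norm N"
  shows "norm_topology N = euclidean"
proof -
  from assms obtain c C where N: "is_norm N" and cC: "c > 0" "C > 0"
    "\<And>x. c * norm x \<le> N x" "\<And>x. N x \<le> C * norm x"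
    unfolding equivalent_norm_def by blast
  note N = N[unfolded is_norm_def]
  have swap: "N (x - y) = N (y - x)" for x y
    using N[THEN conjunct2, THEN conjunct2, THEN conjunct1, rule_format, of "-1" "x - y"] by simp
  interpret M: Metric_space UNIV "\<lambda>x y. N (x - y)"
  proof
    show "N (x - z) \<le> N (x - y) + N (y - z)" for x y z
      using N[THEN conjunct2, THEN conjunct2, THEN conjunct2, rule_format, of "x - y" "y - z"] by simp
  qed (use N swap in auto)
  have "openin M.mtopology U \<longleftrightarrow> open U" for U
    unfolding M.openin_mtopology open_dist
  proof (intro iffI conjI ballI allI impI subset_UNIV)
    fix x assume "U \<subseteq> UNIV \<and> (\<forall>x. x \<in> U \<longrightarrow> (\<exists>r>0. M.mball x r \<subseteq> U))" "x \<in> U"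
    then obtain r where r: "r > 0" "M.mball x r \<subseteq> U" by blast
    have "y \<in> U" if "dist y x < r / C" for y
    proof -
      have "N (x - y) \<le> C * norm (x - y)" by (rule cC)
      also have "\<dots> < r"
        using that cC by (simp add: dist_norm norm_minus_commute field_simps)
      finally show ?thesis using r by (auto simp: M.mball_def)
    qed
    then show "\<exists>e>0. \<forall>y. dist y x < e \<longrightarrow> y \<in> U"
      using r cC by (intro exI[of _ "r / C"]) auto
  next
    fix x assume "\<forall>x\<in>U. \<exists>e>0. \<forall>y. dist y x < e \<longrightarrow> y \<in> U" "x \<in> U"
    then obtain r where r: "r > 0" "\<And>y. dist y x < r \<Longrightarrow> y \<in> U" by blast
    have "y \<in> U" if "N (x - y) < c * r" for y
    proof -
      have "c * norm (x - y) < c * r" using cC(3)[of "x - y"] that by linarith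
      then show ?thesis using cC r by (simp add: dist_norm norm_minus_commute)
    qed
    then show "\<exists>r>0. M.mball x r \<subseteq> U"
      using r cC by (intro exI[of _ "c * r"]) (auto simp: M.mball_def)
  qed
  then show ?thesis
    by (simp add: norm_topology_def topology_eq)
qed

section \<open>Voronoi cell of the origin and the tiling by its translates\<close>

locale voronoi_lattice =
  fixes D :: "'a::real_inner set"
  assumes subgroup: "additive_subgroup D"
    and separated: "\<And>d. d \<in> D \<Longrightarrow> d \<noteq> 0 \<Longrightarrow> 2 \<le> d \<bullet> d"
    and dense: "\<And>x. \<exists>d\<in>D. norm (x - d) \<le> 1"
begin

text \<open>Squaring \<open>norm x \<le> norm (x - d)\<close> yields this half-space form, which
  makes closedness and convexity immediate.\<close>

definition cell :: "'a set"
  where "cell = {x. \<forall>d\<in>D. 2 * (x \<bullet> d) \<le> d \<bullet> d}"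

text \<open>The term for \<open>d = 0\<close> is \<open>0 / 0 = 0\<close>, hence harmless.\<close>

definition gauge :: "'a \<Rightarrow> real"
  where "gauge x = (SUP d\<in>D. 2 * (x \<bullet> d) / (d \<bullet> d))"

lemma zero_in: "0 \<in> D" and add_in: "x \<in> D \<Longrightarrow> y \<in> D \<Longrightarrow> x + y \<in> D"
  and uminus_in: "x \<in> D \<Longrightarrow> - x \<in> D"
  using subgroup by (auto simp: additive_subgroup_def)

lemma diff_in: "x \<in> D \<Longrightarrow> y \<in> D \<Longrightarrow> x - y \<in> D"
  using add_in[of x "- y"] uminus_in by simp

lemma inner_diff_self: "(x - d) \<bullet> (x - d) = x \<bullet> x - 2 * (x \<bullet> d) + d \<bullet> d"
  for x d :: 'a
  by (simp add: inner_diff_left inner_diff_right inner_commute)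

lemma mem_cell: "x \<in> cell \<longleftrightarrow> (\<forall>d\<in>D. norm x \<le> norm (x - d))"
  unfolding cell_def norm_le inner_diff_self by auto

text \<open>For \<open>u = x - d\<close> and \<open>v = x - e\<close>, separation gives
  \<open>2 * (u \<bullet> v) \<le> 2 * s\<^sup>2 - 2\<close>, so \<open>finite_obtuse\<close>
  applies with \<open>\<delta> = 1 - s\<^sup>2\<close>. At \<open>s = 1\<close> this bound
  degenerates to 0.\<close>

lemma finite_close:
  assumes "s < 1"
  shows "finite {d \<in> D. norm (x - d) \<le> s}"
proof (cases "s < 0")
  case True
  then have "{d \<in> D. norm (x - d) \<le> s} = {}"
    by (auto simp: not_le intro: less_le_trans[OF _ norm_ge_zero])
  then show ?thesis by (simp only: finite.emptyI)
next
  case False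
  let ?S = "{d \<in> D. norm (x - d) \<le> s}"
  have sq: "u \<bullet> u \<le> s\<^sup>2" if "norm u \<le> s" for u :: 'a
    using that False by (metis norm_ge_zero power2_norm_eq_inner power_mono)
  have "finite ((\<lambda>d. x - d) ` ?S)"
  proof (rule finite_obtuse[of _ "s\<^sup>2" "1 - s\<^sup>2"])
    show "1 - s\<^sup>2 > 0"
      using assms False by (simp add: power_less_one_iff abs_square_less_1)
    fix u v assume "u \<in> (\<lambda>d. x - d) ` ?S" "v \<in> (\<lambda>d. x - d) ` ?S" "u \<noteq> v"
    then obtain d e where de: "d \<in> D" "e \<in> D" "u = x - d" "v = x - e" "d \<noteq> e"
      "norm u \<le> s" "norm v \<le> s" by auto
    have "2 \<le> (u - v) \<bullet> (u - v)"
      using separated[of "e - d"] de diff_in by simp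
    then show "u \<bullet> v \<le> - (1 - s\<^sup>2)"
      using sq[of u] sq[of v] de(6,7) unfolding inner_diff_self by simp
  qed (use sq in auto)
  then show ?thesis
    by (rule finite_imageD) (auto simp: inj_on_def)
qed

text \<open>A point of \<open>D\<close> closer than 1 leaves only finitely many competitors.
  Otherwise all distances are at least 1, and the point provided by \<open>dense\<close> attains the
  minimum.\<close>

lemma ex_nearest: "\<exists>d\<in>D. \<forall>e\<in>D. norm (x - d) \<le> norm (x - e)"
proof (cases "\<exists>d\<in>D. norm (x - d) < 1")
  case False
  then show ?thesis
    using dense[of x] by (meson not_le order_trans)
next
  case True
  then obtain a where a: "a \<in> D" "norm (x - a) < 1" by blast
  let ?S = "{d \<in> D. norm (x - d) \<le> norm (x - a)}"
  have fin: "finite ?S" "?S \<noteq> {}" using finite_close a by auto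
  obtain d where d: "d \<in> ?S" "\<And>e. e \<in> ?S \<Longrightarrow> norm (x - d) \<le> norm (x - e)"
    using ex_min_if_finite[of "(\<lambda>d. norm (x - d)) ` ?S"] fin by (auto simp: not_less)
  then have "norm (x - d) \<le> norm (x - e)" if "e \<in> D" for e
    using that by (cases "e \<in> ?S") auto
  then show ?thesis using d by blast
qed

lemma ex_in_cell: "\<exists>d\<in>D. x - d \<in> cell"
proof -
  obtain d where d: "d \<in> D" "\<And>e. e \<in> D \<Longrightarrow> norm (x - d) \<le> norm (x - e)"
    using ex_nearest by blast
  have "norm (x - d) \<le> norm (x - d - e)" if "e \<in> D" for e
    using d(2)[OF add_in[OF d(1) that]] by (simp add: diff_diff_eq)
  then show ?thesis using d(1) by (auto simp: mem_cell)
qed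

text \<open>For a point of the cell, 0 is a nearest element of \<open>D\<close>, so
  \<open>dense\<close> bounds the distance to 0.\<close>

lemma norm_le_1: "x \<in> cell \<Longrightarrow> norm x \<le> 1"
  using dense[of x] by (auto simp: mem_cell intro: order_trans)

lemma uminus_cell: "uminus ` cell = cell"
proof -
  have "- x \<in> cell" if "x \<in> cell" for x
    using that uminus_in by (fastforce simp: cell_def)
  then show ?thesis by (force intro: image_eqI[where x = "- _"])
qed

lemma cell_eq_Int: "cell = (\<Inter>d\<in>D. {x. d \<bullet> x \<le> (d \<bullet> d) / 2})"
  by (auto simp: cell_def inner_commute field_simps)

lemma closed_cell: "closed cell"
  unfolding cell_eq_Int by (intro closed_INT ballI closed_halfspace_le)

lemma convex_cell: "convex cell"
  unfolding cell_eq_Int by (intro convex_INT convex_halfspace_le)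

text \<open>Nonzero elements of \<open>D\<close> have norm at least 1, hence distance more than 1/2
  from such a point.\<close>

lemma ball_subset_cell: "ball 0 (1/2) \<subseteq> cell"
proof
  fix x :: 'a assume "x \<in> ball 0 (1/2)"
  then have x: "norm x < 1/2" by simp
  have "norm x \<le> norm (x - d)" if "d \<in> D" for d
  proof (cases "d = 0")
    case False
    then have "1 \<le> norm d"
      using separated[OF that] by (simp add: norm_eq_sqrt_inner)
    then show ?thesis
      using x norm_triangle_ineq2[of d x] by (simp add: norm_minus_commute)
  qed simp
  then show "x \<in> cell" by (simp add: mem_cell)
qed

lemma interior_cell_nonempty: "interior cell \<noteq> {}"
  using interior_maximal[OF ball_subset_cell open_ball] by auto

lemma closure_interior_cell: "closure (interior cell) = cell"
  using subset_closure_interior[OF convex_cell ball_subset_cell] closed_cell interior_subset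
  by (metis closure_closed closure_mono half_gt_zero_iff subset_antisym zero_less_one)

lemma body_translate: "body_in euclidean ((+) d ` cell)"
  by (simp add: body_in_def interior_translation closure_translation interior_cell_nonempty
      closure_interior_cell)

text \<open>An overlap would contain a ball of points equidistant from \<open>d\<close> and
  \<open>e\<close>, but such points form a hyperplane.\<close>

lemma disjnt_interiors:
  assumes "d \<in> D" "e \<in> D" "d \<noteq> e"
  shows "interior ((+) d ` cell) \<inter> interior ((+) e ` cell) = {}"
proof (rule ccontr)
  assume "\<not> ?thesis"
  moreover have "open (interior ((+) d ` cell) \<inter> interior ((+) e ` cell))" by auto
  ultimately obtain p \<epsilon> where p: "\<epsilon> > 0"
    "ball p \<epsilon> \<subseteq> interior ((+) d ` cell) \<inter> interior ((+) e ` cell)"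
    by (meson ex_in_conv open_contains_ball)
  have eq: "norm (q - d) = norm (q - e)" if "q \<in> ball p \<epsilon>" for q
  proof -
    have "q - d \<in> cell" "q - e \<in> cell"
      using that p(2) interior_subset by fastforce+
    then have "norm (q - d) \<le> norm (q - d - (e - d))" "norm (q - e) \<le> norm (q - e - (d - e))"
      using diff_in[OF assms(1,2)] diff_in[OF assms(2,1)] unfolding mem_cell by blast+
    then show ?thesis by simp
  qed
  \<comment> \<open>A step of length \<open>\<epsilon> / 2\<close> along the normal
    \<open>d - e\<close> stays in the ball but leaves the hyperplane.\<close>
  define t where "t = \<epsilon> / (2 * norm (d - e))"
  have t: "t > 0" using p assms by (simp add: t_def)
  have "p + t *\<^sub>R (d - e) \<in> ball p \<epsilon>"
    using p assms by (simp add: dist_norm t_def)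
  moreover have "p \<in> ball p \<epsilon>" using p by simp
  ultimately have "norm (p + t *\<^sub>R (d - e) - d) = norm (p + t *\<^sub>R (d - e) - e)"
    "norm (p - d) = norm (p - e)" by (auto intro!: eq)
  then have "(p + t *\<^sub>R (d - e)) \<bullet> d - p \<bullet> d = (p + t *\<^sub>R (d - e)) \<bullet> e - p \<bullet> e"
    unfolding norm_eq inner_diff_self by simp
  then have "t * ((d - e) \<bullet> (d - e)) = 0"
    by (simp add: inner_add_left inner_diff_right right_diff_distrib)
  then show False using t assms by simp
qed

lemma discrete: "discrete_subgroup euclidean D"
proof -
  have "openin (top_of_set D) {d}" if d: "d \<in> D" for d
  proof -
    have "{d} = D \<inter> ball d 1"
    proof (intro equalityI subsetI)
      fix e assume "e \<in> D \<inter> ball d 1"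
      then have "e - d \<in> D" "norm (e - d) < 1"
        using d diff_in by (auto simp: dist_norm norm_minus_commute)
      then have "(e - d) \<bullet> (e - d) < 1"
        by (metis norm_ge_zero power2_norm_eq_inner power_less_one_iff zero_less_numeral)
      then show "e \<in> {d}"
        using separated[of "e - d"] \<open>e - d \<in> D\<close> by auto
    qed (use d in auto)
    then show ?thesis by (metis open_ball openin_open_Int)
  qed
  then show ?thesis
    using subgroup discrete_topology_unique[of D "top_of_set D"]
    by (simp add: discrete_subgroup_def)
qed

lemma lattice_tiling: "lattice_tiling_by euclidean cell D"
  unfolding lattice_tiling_by_def tiling_def
proof (intro conjI ballI discrete)
  show "body_in euclidean cell"
    using body_translate[of 0] by simp
  show "body_in euclidean T" if "T \<in> {(+) d ` cell |d. d \<in> D}" for T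
    using that body_translate by auto
  have "x \<in> \<Union> {(+) d ` cell |d. d \<in> D}" for x
  proof -
    obtain d where d: "d \<in> D" "x - d \<in> cell" using ex_in_cell by blast
    then have "x \<in> (+) d ` cell" by (intro image_eqI[of _ _ "x - d"]) auto
    then show ?thesis using d by blast
  qed
  then show "\<Union> {(+) d ` cell |d. d \<in> D} = topspace euclidean" by auto
  show "pairwise (\<lambda>S T. disjnt (euclidean interior_of S) (euclidean interior_of T))
     {(+) d ` cell |d. d \<in> D}"
    unfolding pairwise_def disjnt_def using disjnt_interiors by force
qed

section \<open>The gauge of the cell as an equivalent norm\<close>

lemma gauge_term_le:
  assumes "d \<in> D"
  shows "2 * (x \<bullet> d) / (d \<bullet> d) \<le> 2 * norm x"
proof (cases "d = 0")
  case False
  have d: "2 \<le> d \<bullet> d" using separated[OF assms False] .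
  then have "1 \<le> norm d"
    by (simp add: norm_eq_sqrt_inner)
  have "x \<bullet> d \<le> norm x * norm d" by (rule norm_cauchy_schwarz)
  \<comment> \<open>As \<open>norm d \<ge> 1\<close>, a further factor \<open>norm d\<close> only
    enlarges the bound and produces the denominator \<open>d \<bullet> d\<close>.\<close>
  also have "\<dots> \<le> norm x * (norm d * norm d)"
    using \<open>1 \<le> norm d\<close> by (intro mult_left_mono) (auto simp: mult_le_cancel_left1)
  finally have "x \<bullet> d \<le> norm x * (d \<bullet> d)"
    by (simp add: dot_square_norm power2_eq_square)
  then show ?thesis using d by (simp add: divide_le_eq)
qed simp

lemma bdd_gauge: "bdd_above ((\<lambda>d. 2 * (x \<bullet> d) / (d \<bullet> d)) ` D)"
  using gauge_term_le by (intro bdd_aboveI2) auto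

lemma D_nonempty: "D \<noteq> {}"
  using zero_in by auto

lemma gauge_le: "gauge x \<le> 2 * norm x"
  unfolding gauge_def using gauge_term_le by (intro cSUP_least D_nonempty)

lemma gauge_ge: "d \<in> D \<Longrightarrow> 2 * (x \<bullet> d) / (d \<bullet> d) \<le> gauge x"
  unfolding gauge_def by (intro cSUP_upper bdd_gauge)

lemma gauge_nonneg: "0 \<le> gauge x"
  using gauge_ge[OF zero_in, of x] by simp

lemma gauge_le_1_iff: "gauge x \<le> 1 \<longleftrightarrow> x \<in> cell"
proof -
  have "gauge x \<le> 1 \<longleftrightarrow> (\<forall>d\<in>D. 2 * (x \<bullet> d) / (d \<bullet> d) \<le> 1)"
    unfolding gauge_def by (rule cSUP_le_iff[OF D_nonempty bdd_gauge])
  also have "\<dots> \<longleftrightarrow> x \<in> cell"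
    unfolding cell_def mem_Collect_eq
  proof (intro ball_cong refl)
    show "2 * (x \<bullet> d) / (d \<bullet> d) \<le> 1 \<longleftrightarrow> 2 * (x \<bullet> d) \<le> d \<bullet> d" if "d \<in> D" for d
    proof (cases "d = 0")
      case False
      then have "0 < d \<bullet> d" by simp
      then show ?thesis by (simp add: divide_le_eq)
    qed simp
  qed
  finally show ?thesis .
qed

lemma gauge_triangle: "gauge (x + y) \<le> gauge x + gauge y"
proof -
  have "2 * ((x + y) \<bullet> d) / (d \<bullet> d) \<le> gauge x + gauge y" if "d \<in> D" for d
    using gauge_ge[OF that, of x] gauge_ge[OF that, of y]
    by (simp add: inner_add_left add_divide_distrib distrib_left)
  then show ?thesis
    unfolding gauge_def[of "x + y"] by (intro cSUP_least D_nonempty)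
qed

lemma gauge_scaleR_le: "gauge (c *\<^sub>R x) \<le> \<bar>c\<bar> * gauge x"
proof -
  have "2 * ((c *\<^sub>R x) \<bullet> d) / (d \<bullet> d) \<le> \<bar>c\<bar> * gauge x" if "d \<in> D" for d
  proof -
    \<comment> \<open>The term for \<open>- d\<close> is the negative of the term for
      \<open>d\<close>, so the supremum also bounds absolute values.\<close>
    have "2 * (x \<bullet> d) / (d \<bullet> d) \<le> gauge x" "- (2 * (x \<bullet> d) / (d \<bullet> d)) \<le> gauge x"
      using gauge_ge[OF that, of x] gauge_ge[OF uminus_in[OF that], of x] by simp_all
    then have "\<bar>2 * (x \<bullet> d) / (d \<bullet> d)\<bar> \<le> gauge x" by linarith
    then have "\<bar>c\<bar> * \<bar>2 * (x \<bullet> d) / (d \<bullet> d)\<bar> \<le> \<bar>c\<bar> * gauge x"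
      by (intro mult_left_mono) auto
    moreover have "2 * ((c *\<^sub>R x) \<bullet> d) / (d \<bullet> d) = c * (2 * (x \<bullet> d) / (d \<bullet> d))"
      by simp
    ultimately show ?thesis
      by (metis abs_ge_self abs_mult order_trans)
  qed
  then show ?thesis
    unfolding gauge_def[of "c *\<^sub>R x"] by (intro cSUP_least D_nonempty)
qed

lemma gauge_scaleR: "gauge (c *\<^sub>R x) = \<bar>c\<bar> * gauge x"
proof (cases "c = 0")
  case True
  then show ?thesis using gauge_le[of 0] gauge_nonneg[of 0] by simp
next
  case False
  \<comment> \<open>The reverse inequality comes from scaling back by \<open>1 / c\<close>.\<close>
  have "gauge x \<le> \<bar>1 / c\<bar> * gauge (c *\<^sub>R x)"
    using gauge_scaleR_le[of "1 / c" "c *\<^sub>R x"] False by simp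
  then have "\<bar>c\<bar> * gauge x \<le> gauge (c *\<^sub>R x)"
    using False by (simp add: field_simps)
  then show ?thesis using gauge_scaleR_le[of c x] by linarith
qed

text \<open>For every \<open>r > gauge x\<close> the point \<open>x / r\<close> lies in the cell,
  hence in the unit ball. A strictly larger \<open>r\<close> avoids dividing by a gauge that might
  be 0.\<close>

lemma norm_le_gauge: "norm x \<le> gauge x"
proof (rule dense_ge)
  fix r assume r: "gauge x < r"
  then have "r > 0" using gauge_nonneg[of x] by linarith
  then have "gauge ((1 / r) *\<^sub>R x) \<le> 1"
    using r by (simp add: gauge_scaleR)
  then have "norm ((1 / r) *\<^sub>R x) \<le> 1"
    using gauge_le_1_iff norm_le_1 by blast
  then show "norm x \<le> r" using \<open>r > 0\<close> by (simp add: field_simps)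
qed

lemma equivalent_norm_gauge: "equivalent_norm gauge"
proof -
  have "gauge x = 0 \<longleftrightarrow> x = 0" for x
    using norm_le_gauge[of x] gauge_le[of x] by auto
  then have "is_norm gauge"
    by (simp add: is_norm_def gauge_nonneg gauge_scaleR gauge_triangle)
  moreover have "\<forall>x. 1 * norm x \<le> gauge x \<and> gauge x \<le> 2 * norm x"
    using norm_le_gauge gauge_le by simp
  ultimately show ?thesis
    unfolding equivalent_norm_def by (meson zero_less_one zero_less_numeral)
qed

lemma tiling_by_gauge_balls: "admits_lattice_tiling_by_balls gauge"
  using lattice_tiling unfolding admits_lattice_tiling_by_balls_def gauge_le_1_iff
    norm_topology_equivalent[OF equivalent_norm_gauge] by auto

lemma convex_body_cell: "bounded cell" "convex_body_in euclidean cell"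
  using norm_le_1 closed_cell convex_cell interior_cell_nonempty
  by (auto simp: bounded_iff convex_body_in_def)

end

section \<open>Transfinite construction of the lattice\<close>

text \<open>The subgroup generated by the family. Coefficients sit on indices, so that a well-order
  of the indices can single out a leading generator.\<close>

definition int_span :: "('i \<Rightarrow> 'a::real_vector) \<Rightarrow> 'i set \<Rightarrow> 'a set"
  where "int_span g A = {\<Sum>i\<in>F. of_int (k i) *\<^sub>R g i |F k. finite F \<and> F \<subseteq> A}"

lemma int_spanI: "finite F \<Longrightarrow> F \<subseteq> A \<Longrightarrow> (\<Sum>i\<in>F. of_int (k i) *\<^sub>R g i) \<in> int_span g A"
  unfolding int_span_def by blast

lemma int_span_mono: "A \<subseteq> B \<Longrightarrow> int_span g A \<subseteq> int_span g B"
  unfolding int_span_def by blast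

lemma int_span_base: "i \<in> A \<Longrightarrow> g i \<in> int_span g A"
  using int_spanI[of "{i}" A "\<lambda>_. 1" g] by simp

lemma subgroup_int_span: "additive_subgroup (int_span g A)"
  unfolding additive_subgroup_def
proof (intro conjI ballI)
  show "0 \<in> int_span g A"
    using int_spanI[of "{}" A _ g] by simp
next
  fix x assume "x \<in> int_span g A"
  then obtain F k where F: "finite F" "F \<subseteq> A" "x = (\<Sum>i\<in>F. of_int (k i) *\<^sub>R g i)"
    unfolding int_span_def by blast
  show "- x \<in> int_span g A"
    using int_spanI[OF F(1,2), of "\<lambda>i. - k i" g] F(3) by (simp add: sum_negf)
  fix y assume "y \<in> int_span g A"
  then obtain F' k' where F': "finite F'" "F' \<subseteq> A" "y = (\<Sum>i\<in>F'. of_int (k' i) *\<^sub>R g i)"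
    unfolding int_span_def by blast
  \<comment> \<open>Both coefficient functions are extended by 0 to
    \<open>F \<union> F'\<close>.\<close>
  let ?k = "\<lambda>i. (if i \<in> F then k i else 0) + (if i \<in> F' then k' i else 0)"
  have "x = (\<Sum>i\<in>F \<union> F'. of_int (if i \<in> F then k i else 0) *\<^sub>R g i)"
    unfolding F(3) using F F' by (intro sum.mono_neutral_cong_left) auto
  moreover have "y = (\<Sum>i\<in>F \<union> F'. of_int (if i \<in> F' then k' i else 0) *\<^sub>R g i)"
    unfolding F'(3) using F F' by (intro sum.mono_neutral_cong_left) auto
  ultimately have "x + y = (\<Sum>i\<in>F \<union> F'. of_int (?k i) *\<^sub>R g i)"
    by (simp add: sum.distrib[symmetric] scaleR_add_left[symmetric])
  then show "x + y \<in> int_span g A"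
    using int_spanI[of "F \<union> F'" A ?k g] F F' by simp
qed

lemma int_span_orthogonal:
  assumes "v \<in> int_span g A" "\<And>i. i \<in> A \<Longrightarrow> g i \<bullet> e = 0"
  shows "v \<bullet> e = 0"
  using assms unfolding int_span_def
  by (force simp: inner_sum_left intro!: sum.neutral)

text \<open>Once zero coefficients are dropped, the finite non-empty rest has an
  \<open>R\<close>-maximal index \<open>m\<close>; by totality all others precede it.\<close>

lemma int_span_leading_term:
  assumes v: "v \<in> int_span g A" "v \<noteq> 0" and R: "wf R" "trans R" "total R"
  obtains m w and k :: int where "m \<in> A" "k \<noteq> 0" "w \<in> int_span g (A \<inter> {b. (b, m) \<in> R})"
    "v = w + of_int k *\<^sub>R g m"
proof -
  obtain F k where F: "finite F" "F \<subseteq> A" "v = (\<Sum>i\<in>F. of_int (k i) *\<^sub>R g i)"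
    using v unfolding int_span_def by blast
  define G where "G = {i \<in> F. k i \<noteq> (0::int)}"
  have vG: "v = (\<Sum>i\<in>G. of_int (k i) *\<^sub>R g i)"
    unfolding F(3) G_def using F by (intro sum.mono_neutral_right) auto
  have "G \<noteq> {}"
    using v(2) unfolding vG by (metis sum.empty)
  then have G: "finite G" "G \<noteq> {}" "G \<subseteq> A"
    using F by (auto simp: G_def)
  have "asymp_on G (\<lambda>a b. (a, b) \<in> R)" "transp_on G (\<lambda>a b. (a, b) \<in> R)"
    using wf_asym[OF R(1)] R(2) by (auto intro: transp_onI dest: transD)
  then obtain m where m: "m \<in> G" "\<And>b. b \<in> G \<Longrightarrow> b \<noteq> m \<Longrightarrow> (m, b) \<notin> R"
    using Finite_Set.bex_max_element[OF G(1)] G(2) by blast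
  have "G - {m} \<subseteq> A \<inter> {b. (b, m) \<in> R}"
    using m R(3) G(3) unfolding total_on_def by blast
  then have "(\<Sum>i\<in>G - {m}. of_int (k i) *\<^sub>R g i) \<in> int_span g (A \<inter> {b. (b, m) \<in> R})"
    using G by (intro int_spanI) auto
  moreover have "v = (\<Sum>i\<in>G - {m}. of_int (k i) *\<^sub>R g i) + of_int (k m) *\<^sub>R g m"
    unfolding vG using G m by (simp add: sum.remove add.commute)
  ultimately show ?thesis
    using that[of m "k m"] m G by (auto simp: G_def)
qed

text \<open>Well-founded recursion on the characteristic predicate: membership of \<open>a\<close>
  is decided from the part of the set before \<open>a\<close>.\<close>

lemma ex_recursive_set:
  assumes "wf R"
  shows "\<exists>A. \<forall>a. a \<in> A \<longleftrightarrow> P a (A \<inter> {b. (b, a) \<in> R})"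
proof -
  let ?Q = "\<lambda>f a r. r = P a ({b. f b} \<inter> {b. (b, a) \<in> R})"
  have "\<exists>f. \<forall>a. ?Q f a (f a)"
  proof (rule dependent_wf_choice[OF assms])
    fix f g :: "'a \<Rightarrow> bool" and x r
    assume "\<And>z. (z, x) \<in> R \<Longrightarrow> f z = g z"
    then have "{b. f b} \<inter> {b. (b, x) \<in> R} = {b. g b} \<inter> {b. (b, x) \<in> R}" by auto
    then show "?Q f x r = ?Q g x r" by simp
  qed simp
  then obtain f where "\<forall>a. ?Q f a (f a)" ..
  then have "\<forall>a. a \<in> {b. f b} \<longleftrightarrow> P a ({b. f b} \<inter> {b. (b, a) \<in> R})"
    unfolding mem_Collect_eq .
  then show ?thesis by (rule exI)
qed

text \<open>The generator \<open>y a + e a\<close> lies at distance \<open>1\<close> from \<open>y a\<close>, while its squared distance to the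
  group generated before is at least \<open>1 + 1\<close>. Multiples \<open>k (y a + e a)\<close> with \<open>\<bar>k\<bar> \<ge> 2\<close> already
  have squared distance at least \<open>4\<close> because of the component along \<open>e a\<close>.\<close>

lemma ex_voronoi_lattice:
  fixes y e :: "'i \<Rightarrow> 'a::real_inner"
  assumes R: "wf R" "trans R" "total R" and "surj y"
    and unit: "\<And>a. e a \<bullet> e a = 1"
    and y_e: "\<And>a b. b = a \<or> (b, a) \<in> R \<Longrightarrow> y b \<bullet> e a = 0"
    and e_e: "\<And>a b. (b, a) \<in> R \<Longrightarrow> e b \<bullet> e a = 0"
  shows "\<exists>D :: 'a set. voronoi_lattice D"
proof -
  define g where "g = (\<lambda>a. y a + e a)"
  obtain A where A: "\<And>a. a \<in> A \<longleftrightarrow> (\<forall>d\<in>int_span g (A \<inter> {b. (b, a) \<in> R}). 1 \<le> norm (y a - d))"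
    using ex_recursive_set[OF R(1), of "\<lambda>a S. \<forall>d\<in>int_span g S. 1 \<le> norm (y a - d)"] by blast
  have "voronoi_lattice (int_span g A)"
  proof
    fix v assume v: "v \<in> int_span g A" "v \<noteq> 0"
    obtain m w and k :: int where m: "m \<in> A" "k \<noteq> 0" "w \<in> int_span g (A \<inter> {b. (b, m) \<in> R})"
      "v = w + of_int k *\<^sub>R g m"
      by (rule int_span_leading_term[OF v R])
    \<comment> \<open>\<open>u\<close> collects what is orthogonal to \<open>e m\<close>, so
      \<open>vv\<close> below is Pythagoras.\<close>
    define u where "u = w + of_int k *\<^sub>R y m"
    have "w \<bullet> e m = 0"
      using m(3) by (rule int_span_orthogonal) (simp add: g_def inner_add_left y_e e_e)
    then have ue: "u \<bullet> e m = 0" by (simp add: u_def inner_add_left y_e)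
    have "v = u + of_int k *\<^sub>R e m"
      using m(4) by (simp add: u_def g_def scaleR_add_right)
    then have vv: "v \<bullet> v = u \<bullet> u + (of_int k)\<^sup>2"
      using ue unit[of m] by (simp add: inner_add_left inner_add_right inner_commute power2_eq_square)
    show "2 \<le> v \<bullet> v"
    proof (cases "\<bar>k\<bar> = 1")
      case True
      \<comment> \<open>For \<open>k = 1\<close> or \<open>k = -1\<close>, \<open>u\<close> is up to
        sign \<open>y m + w\<close> or \<open>y m - w\<close>. The earlier group contains both
        \<open>w\<close> and \<open>- w\<close>, so \<open>m \<in> A\<close> bounds either norm
        below by 1.\<close>
      have "- w \<in> int_span g (A \<inter> {b. (b, m) \<in> R})"
        using subgroup_int_span m(3) unfolding additive_subgroup_def by blast
      then have "1 \<le> norm (y m - w)" "1 \<le> norm (y m - - w)"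
        using m(1,3) A by blast+
      moreover have "norm u = norm (y m - - w) \<or> norm u = norm (y m - w)"
        using True by (auto simp: u_def abs_if add.commute norm_minus_commute split: if_splits)
      ultimately have "1 \<le> norm u" by auto
      then have "1 \<le> u \<bullet> u" by (simp add: norm_eq_sqrt_inner)
      moreover have "(of_int k :: real)\<^sup>2 = 1" using True by (auto simp: abs_if split: if_splits)
      ultimately show ?thesis using vv by linarith
    next
      case False
      then have "2 \<le> \<bar>of_int k :: real\<bar>" using m(2) by linarith
      then have "2\<^sup>2 \<le> (of_int k :: real)\<^sup>2" by (metis abs_numeral power2_abs power_mono zero_le_numeral)
      then have "4 \<le> (of_int k :: real)\<^sup>2" by simp
      then show ?thesis using vv inner_ge_zero[of u] by linarith
    qed
  next
    fix x
    obtain a where a: "x = y a" using \<open>surj y\<close> by blast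
    show "\<exists>d\<in>int_span g A. norm (x - d) \<le> 1"
    proof (cases "a \<in> A")
      case True
      have "norm (x - g a) = 1"
        using unit[of a] a by (simp add: g_def norm_eq_sqrt_inner)
      then show ?thesis using int_span_base[OF True, of g] by (intro bexI[of _ "g a"]) auto
    next
      case False
      then obtain d where "d \<in> int_span g (A \<inter> {b. (b, a) \<in> R})" "norm (y a - d) < 1"
        using A[of a] by (auto simp: not_le)
      then show ?thesis using a int_span_mono[of "A \<inter> {b. (b, a) \<in> R}" A g] by force
    qed
  qed (rule subgroup_int_span)
  then show ?thesis ..
qed

section \<open>Fresh coordinates\<close>

lift_definition unit_vector :: "'g \<Rightarrow> 'g ell2" is "\<lambda>i j. if j = i then 1 else 0"
  by (rule finite_nonzero_values_imp_summable_on) simp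

lemma inner_unit_vector: "x \<bullet> unit_vector i = coord x i"
proof -
  have "(\<Sum>\<^sub>\<infinity>j. coord x j * coord (unit_vector i) j) = (\<Sum>\<^sub>\<infinity>j\<in>{i}. coord x j)"
    by (rule infsum_cong_neutral) (auto simp: unit_vector.rep_eq)
  then show ?thesis by (simp add: inner_ell2.rep_eq)
qed

lemma countable_support: "countable {i. coord x i \<noteq> 0}"
proof -
  have "countable {i \<in> UNIV. (coord x i)\<^sup>2 \<noteq> 0}"
    using coord[of x] by (intro summable_countable_real) simp
  then show ?thesis by simp
qed

text \<open>A real is determined by the rationals below it, hence by a sequence of two symbols,
  which \<open>J\<close> codes as one index. The embedding serves to code coefficients and to show
  that the index type is uncountable.\<close>

lemma inj_real_coding:
  fixes J :: "(nat \<Rightarrow> 'g) \<Rightarrow> 'g"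
  assumes "infinite (UNIV :: 'g set)" "inj J"
  obtains c :: "real \<Rightarrow> 'g" where "inj c"
proof -
  obtain a b :: 'g where ab: "a \<noteq> b"
    using assms(1) by (metis (full_types) UNIV_eq_I finite.simps singletonI)
  define h :: "real \<Rightarrow> nat \<Rightarrow> 'g" where "h = (\<lambda>x n. if from_nat_into \<rat> n < x then a else b)"
  have "h x \<noteq> h y" if less: "x < y" for x y
  proof -
    obtain q where q: "q \<in> \<rat>" "x < q" "q < y"
      using Rats_dense_in_real[OF less] by blast
    then obtain n where "from_nat_into \<rat> n = q"
      using from_nat_into_surj[OF countable_rat] by blast
    then have "h x n \<noteq> h y n" using q ab by (simp add: h_def)
    then show ?thesis by auto
  qed
  then have "inj h" by (metis injI linorder_neqE_linordered_idom)
  then show ?thesis using that[of "J \<circ> h"] assms(2) by (simp add: inj_compose)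
qed

text \<open>A vector is determined by an enumeration of its countable support and the coordinates
  along it. Coding both in one index is injective, and a left inverse is onto.\<close>

lemma ell2_surjection:
  fixes J :: "(nat \<Rightarrow> 'g) \<Rightarrow> 'g" and c :: "real \<Rightarrow> 'g"
  assumes J: "inj J" and c: "inj c"
  obtains y :: "'g \<Rightarrow> 'g ell2" where "surj y"
proof -
  \<comment> \<open>At \<open>x = 0\<close> the enumerated set is empty and \<open>s x\<close>
    arbitrary; what matters is that coordinates outside \<open>range (s x)\<close> vanish.\<close>
  define s :: "'g ell2 \<Rightarrow> nat \<Rightarrow> 'g" where "s = (\<lambda>x. from_nat_into {i. coord x i \<noteq> 0})"
  define code where "code = (\<lambda>x. (s x, \<lambda>n. c (coord x (s x n))))"
  have zero: "coord x i = 0" if "i \<notin> range (s x)" for x i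
    using that from_nat_into_surj[OF countable_support[of x], of i] by (auto simp: s_def)
  have "inj code"
  proof (rule injI)
    fix x y assume "code x = code y"
    then have eq: "s x = s y" "\<And>n. coord x (s x n) = coord y (s x n)"
      using c by (auto simp: code_def inj_eq fun_eq_iff)
    have "coord x i = coord y i" for i
      using eq zero[of i x] zero[of i y] by (cases "i \<in> range (s x)") auto
    then show "x = y" by (metis coord_inject ext)
  qed
  \<comment> \<open>Two sequences become one by placing the code of the first in front of the
    second.\<close>
  moreover have "inj (\<lambda>(p, q). J (case_nat (J p) (\<lambda>n. q n)))"
  proof (rule injI, clarify)
    fix p q p' q' :: "nat \<Rightarrow> 'g"
    assume "J (case_nat (J p) (\<lambda>n. q n)) = J (case_nat (J p') (\<lambda>n. q' n))"
    then have "case_nat (J p) q = case_nat (J p') q'" using J by (simp add: inj_eq)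
    then have "case_nat (J p) q n = case_nat (J p') q' n" for n by simp
    from this[of 0] this[of "Suc _"] show "p = p' \<and> q = q'"
      using J by (auto simp: inj_eq)
  qed
  ultimately have "inj ((\<lambda>(p, q). J (case_nat (J p) (\<lambda>n. q n))) \<circ> code)"
    by (rule inj_compose[rotated])
  then show ?thesis using that inj_imp_surj_inv by blast
qed

section \<open>Cardinal bounds and the choice of fresh coordinates\<close>

lemma countable_iff_ordLeq: "countable A \<longleftrightarrow> |A| \<le>o |UNIV :: nat set|"
  by (simp add: countable_def card_of_ordLeq[symmetric])

lemma countable_ordLess_uncountable:
  assumes "countable A" "uncountable B"
  shows "|A| <o |B|"
proof -
  have "\<not> |B| \<le>o |A|"
    using assms countable_iff_ordLeq ordLeq_transitive by metis
  then show ?thesis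
    using not_ordLeq_iff_ordLess[OF card_of_Well_order card_of_Well_order] by blast
qed

text \<open>The index set and all members are bounded by the single cardinal
  \<open>|I <+> UNIV|\<close>, which is infinite even for finite \<open>I\<close> and still below
  that of \<open>'g\<close>; hence so is the union.\<close>

lemma small_union_ordLess:
  fixes S :: "'i \<Rightarrow> 'g set"
  assumes unc: "uncountable (UNIV :: 'g set)" and I: "|I| <o |UNIV :: 'g set|"
    and S: "\<And>i. i \<in> I \<Longrightarrow> countable (S i)"
  shows "|\<Union>i\<in>I. S i| <o |UNIV :: 'g set|"
proof -
  have "|UNIV :: nat set| <o |UNIV :: 'g set|"
    using unc by (intro countable_ordLess_uncountable countableI_type)
  then have less: "|I <+> (UNIV :: nat set)| <o |UNIV :: 'g set|"
    using card_of_Plus_ordLess_infinite I unc uncountable_infinite by blast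
  have "|S i| \<le>o |I <+> (UNIV :: nat set)|" if "i \<in> I" for i
    using S[OF that] ordLeq_transitive[OF _ card_of_Plus2] by (simp add: countable_iff_ordLeq)
  then have "|\<Union>i\<in>I. S i| \<le>o |I <+> (UNIV :: nat set)|"
    by (intro card_of_UNION_ordLeq_infinite card_of_Plus1 ballI) auto
  then show ?thesis using less ordLeq_ordLess_trans by blast
qed

text \<open>At stage \<open>a\<close> the sets \<open>S b\<close> up to \<open>a\<close> and the
  earlier choices exclude fewer coordinates than there are, so the recursion never gets
  stuck.\<close>

lemma ex_fresh:
  fixes S :: "'g \<Rightarrow> 'g set"
  assumes unc: "uncountable (UNIV :: 'g set)" and S: "\<And>a. countable (S a)"
    and R: "wf R" "\<And>a. |{b. (b, a) \<in> R}| <o |UNIV :: 'g set|"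
  obtains \<gamma> :: "'g \<Rightarrow> 'g" where "\<And>a b. b = a \<or> (b, a) \<in> R \<Longrightarrow> \<gamma> a \<notin> S b"
    "\<And>a b. (b, a) \<in> R \<Longrightarrow> \<gamma> a \<noteq> \<gamma> b"
proof -
  let ?Q = "\<lambda>f a r. r \<notin> S a \<and> (\<forall>b. (b, a) \<in> R \<longrightarrow> r \<notin> S b \<and> r \<noteq> f b)"
  have "\<exists>f. \<forall>a. ?Q f a (f a)"
  proof (rule dependent_wf_choice[OF R(1)])
    fix a and f :: "'g \<Rightarrow> 'g"
    have "|insert a {b. (b, a) \<in> R}| <o |UNIV :: 'g set|"
      using R(2) card_of_Un_ordLess_infinite[of "UNIV :: 'g set" "{a}"] unc
      by (simp add: countable_ordLess_uncountable uncountable_infinite)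
    then have "|\<Union>b\<in>insert a {b. (b, a) \<in> R}. S b \<union> {f b}| <o |UNIV :: 'g set|"
      using S by (intro small_union_ordLess[OF unc]) auto
    then have "(\<Union>b\<in>insert a {b. (b, a) \<in> R}. S b \<union> {f b}) \<noteq> UNIV"
      using ordLess_irreflexive by metis
    then show "\<exists>r. ?Q f a r" by blast
  qed simp
  then obtain f where f: "\<forall>a. ?Q f a (f a)" ..
  show ?thesis by (rule that[of f]) (use f in blast)+
qed

lemma ex_voronoi_lattice_ell2:
  assumes inf: "infinite (UNIV :: 'g set)"
    and pow: "|UNIV :: 'g set| ^c natLeq =o |UNIV :: 'g set|"
  shows "\<exists>D :: 'g ell2 set. voronoi_lattice D"
proof -
  have "|UNIV :: (nat \<Rightarrow> 'g) set| =o |UNIV :: 'g set|"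
    using pow by (simp add: cexp_def Field_natLeq Field_card_of Func_def)
  then obtain J :: "(nat \<Rightarrow> 'g) \<Rightarrow> 'g" where J: "inj J"
    using card_of_ordIso[of "UNIV :: (nat \<Rightarrow> 'g) set" "UNIV :: 'g set"] by (auto simp: bij_betw_def)
  obtain c :: "real \<Rightarrow> 'g" where c: "inj c" using inj_real_coding[OF inf J] .
  have unc: "uncountable (UNIV :: 'g set)"
    using c uncountable_UNIV_real by (metis countable_image_inj_on countable_subset subset_UNIV)
  obtain y :: "'g \<Rightarrow> 'g ell2" where y: "surj y" using ell2_surjection[OF J c] .
  \<comment> \<open>This cardinal is itself a well-order of \<open>'g\<close> of minimal type, so
    its proper initial segments are smaller than \<open>'g\<close>; removing the diagonal makes it
    strict.\<close>
  define r where "r = |UNIV :: 'g set|"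
  define R where "R = r - Id"
  have wo: "Well_order r" and F: "Field r = UNIV"
    unfolding r_def by (rule card_of_Well_order, simp add: Field_card_of)
  have R: "wf R" "trans R" "total R"
    using wo F unfolding R_def well_order_on_def linear_order_on_def partial_order_on_def
      preorder_on_def
    by (auto simp: trans_diff_Id)
  have "{b. (b, a) \<in> R} = underS r a" for a
    by (auto simp: R_def underS_def)
  then have small: "|{b. (b, a) \<in> R}| <o |UNIV :: 'g set|" for a
    using card_of_underS[of r a] F by (simp add: r_def card_of_Card_order)
  obtain \<gamma> :: "'g \<Rightarrow> 'g" where
    \<gamma>: "\<And>a b. b = a \<or> (b, a) \<in> R \<Longrightarrow> \<gamma> a \<notin> {i. coord (y b) i \<noteq> 0}"
      "\<And>a b. (b, a) \<in> R \<Longrightarrow> \<gamma> a \<noteq> \<gamma> b"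
    using ex_fresh[of "\<lambda>b. {i. coord (y b) i \<noteq> 0}" R, OF unc countable_support R(1) small] by metis
  show ?thesis
  \<comment> \<open>\<open>\<gamma> a\<close> avoids the supports of all points up to
    \<open>a\<close> and all earlier choices, which is the orthogonality required.\<close>
  proof (rule ex_voronoi_lattice[OF R y, of "\<lambda>a. unit_vector (\<gamma> a)"])
    show "y b \<bullet> unit_vector (\<gamma> a) = 0" if "b = a \<or> (b, a) \<in> R" for a b
      using \<gamma>(1)[OF that] by (simp add: inner_unit_vector)
    show "unit_vector (\<gamma> b) \<bullet> unit_vector (\<gamma> a) = 0" if "(b, a) \<in> R" for a b
      using \<gamma>(2)[OF that] by (simp add: inner_unit_vector unit_vector.rep_eq)
  qed (simp add: inner_unit_vector unit_vector.rep_eq)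
qed

theorem theorem1:
  assumes "infinite (UNIV :: 'g set)"
    and "|UNIV :: 'g set| ^c natLeq =o |UNIV :: 'g set|"
  shows "(\<exists>(B :: 'g ell2 set) (D :: 'g ell2 set).
            bounded B \<and> convex_body_in euclidean B \<and> uminus ` B = B \<and>
            lattice_tiling_by euclidean B D)
       \<and> (\<exists>N :: 'g ell2 \<Rightarrow> real. equivalent_norm N \<and> admits_lattice_tiling_by_balls N)"
proof -
  obtain D :: "'g ell2 set" where "voronoi_lattice D"
    using ex_voronoi_lattice_ell2[OF assms] ..
  then interpret voronoi_lattice D .
  show ?thesis
    using convex_body_cell uminus_cell lattice_tiling equivalent_norm_gauge tiling_by_gauge_balls
    by blast
qed

end
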